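(* Let $G$ be an abelian group. Then $G$ is Bassian-finite if and only if for every monomorphism $\phi:G\to G$ and every non-zero direct summand $B\leq G$, we have $\phi(G)\cap B\neq\{0\}$.
   Context: All groups are abelian, written additively. A group $G$ is Bassian-finite if there is no monomorphism from $G$ to any proper direct summand of $G$ (a direct summand different from $G$). *)

theory Defs
  imports "HOL-Algebra.Coset"
begin

(* Multiplicative notation: \<one> is the zero element of the abelian group, <#> is the sum of subgroups.
   For abelian G, the last two conjuncts say that G is the internal direct sum of B and C. *)
definition direct_summand :: "'a set \<Rightarrow> ('a, 'b) monoid_scheme \<Rightarrow> bool" where
  "direct_summand B G \<longleftrightarrow>
     subgroup B G \<and>
     (\<exists>C. subgroup C G \<and> B \<inter> C = {\<one>\<^bsub>G\<^esub>} \<and> B <#>\<^bsub>G\<^esub> C = carrier G)"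

(* Meant for abelian G only. *)
definition bassian_finite :: "('a, 'b) monoid_scheme \<Rightarrow> bool" where
  "bassian_finite G \<longleftrightarrow>
     \<not> (\<exists>B \<phi>. direct_summand B G \<and> B \<noteq> carrier G \<and> \<phi> \<in> mon G (G\<lparr>carrier := B\<rparr>))"

end

(* A monomorphism whose image meets B trivially stays injective after projecting along B onto a
   complement of B. Conversely, a monomorphism into a proper summand misses the complement. *)
theory Submission
  imports Defs
begin

text \<open>Let G be the internal direct sum of B and C. If a monomorphism \<phi> has image meeting
  B trivially, then the projection p onto C with kernel B is injective on that image, so p after
  \<phi> embeds G in C; this summand is proper as soon as B is non-zero. Conversely, an embedding of
  G into a proper summand B is also a monomorphism from G to G; its image lies in B, hence meets the
  complement C trivially, and C is non-zero because B is proper. The projection comes from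
  \<open>obtain_projection\<close>, which rests on the uniqueness of components in
  \<open>mult_decomposition_unique\<close>.\<close>

lemma (in group) mult_decomposition_unique:
  assumes B: "subgroup B G" and C: "subgroup C G" and BC: "B \<inter> C = {\<one>}"
    and mem: "b \<in> B" "b' \<in> B" "c \<in> C" "c' \<in> C"
    and eq: "b \<otimes> c = b' \<otimes> c'"
  shows "b = b'" and "c = c'"
proof -
  have car: "b \<in> carrier G" "b' \<in> carrier G" "c \<in> carrier G" "c' \<in> carrier G"
    using subgroup.mem_carrier[OF B] subgroup.mem_carrier[OF C] mem by auto
  \<comment> \<open>The left side lies in B and the right side in C, so both are trivial.\<close>
  have "inv b' \<otimes> b = c' \<otimes> inv c"
  proof -
    have "b' \<otimes> (c' \<otimes> inv c) = (b' \<otimes> c') \<otimes> inv c" using car by (simp add: m_assoc)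
    also have "\<dots> = b" unfolding eq[symmetric] using car by (simp add: m_assoc)
    finally have "inv b' \<otimes> b = inv b' \<otimes> (b' \<otimes> (c' \<otimes> inv c))" by simp
    then show ?thesis using car by (simp add: m_assoc[symmetric])
  qed
  moreover have "inv b' \<otimes> b \<in> B" "c' \<otimes> inv c \<in> C"
    using B C mem by (auto intro: subgroup.m_closed subgroup.m_inv_closed)
  ultimately have "inv b' \<otimes> b \<in> B \<inter> C" by simp
  then have "inv b' \<otimes> b = \<one>" unfolding BC by simp
  then show "b = b'" using car by (metis inv_equality inv_inv inv_closed)
  then show "c = c'" using eq car by simp
qed

text \<open>The map takes each element to its C-component. Its codomain is C itself, so that
  composites with it land in the summand.\<close>

lemma (in comm_group) obtain_projection:
  assumes B: "subgroup B G" and C: "subgroup C G" and BC: "B \<inter> C = {\<one>}"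
    and sum: "B <#> C = carrier G"
  obtains p where "p \<in> hom G (G\<lparr>carrier := C\<rparr>)" and "kernel G (G\<lparr>carrier := C\<rparr>) p = B"
proof -
  have "\<forall>x\<in>carrier G. \<exists>q. fst q \<in> B \<and> snd q \<in> C \<and> x = fst q \<otimes> snd q"
    using sum by (fastforce simp: set_mult_def)
  then obtain q where "\<forall>x\<in>carrier G. fst (q x) \<in> B \<and> snd (q x) \<in> C \<and> x = fst (q x) \<otimes> snd (q x)"
    by metis
  then have q: "fst (q x) \<in> B" "snd (q x) \<in> C" "fst (q x) \<otimes> snd (q x) = x"
    if "x \<in> carrier G" for x
    using that by auto
  \<comment> \<open>\<open>q\<close> chooses some decomposition of each element; by uniqueness the
    choice does not matter.\<close>
  have p_eq: "snd (q (b \<otimes> c)) = c" if "b \<in> B" "c \<in> C" for b c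
  proof -
    have "b \<otimes> c \<in> carrier G"
      using that B C by (meson m_closed subgroup.mem_carrier)
    from mult_decomposition_unique(2)[OF B C BC q(1)[OF this] that(1) q(2)[OF this] that(2) q(3)[OF this]]
    show ?thesis .
  qed
  show thesis
  proof
    show "(snd \<circ> q) \<in> hom G (G\<lparr>carrier := C\<rparr>)"
    proof (rule homI)
      fix x y assume x: "x \<in> carrier G" and y: "y \<in> carrier G"
      let ?b = "\<lambda>x. fst (q x)" and ?c = "\<lambda>x. snd (q x)"
      have car: "?b x \<in> carrier G" "?b y \<in> carrier G" "?c x \<in> carrier G" "?c y \<in> carrier G"
        using q x y subgroup.mem_carrier[OF B] subgroup.mem_carrier[OF C] by auto
      have "x \<otimes> y = (?b x \<otimes> ?c x) \<otimes> (?b y \<otimes> ?c y)" using q x y by simp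
      \<comment> \<open>Commutativity collects the two B-components and the two C-components, so
        \<open>p_eq\<close> can read off the result.\<close>
      also have "\<dots> = (?b x \<otimes> ?b y) \<otimes> (?c x \<otimes> ?c y)" using car by (simp add: m_ac)
      finally have "?c (x \<otimes> y) = ?c x \<otimes> ?c y"
        using p_eq[of "?b x \<otimes> ?b y" "?c x \<otimes> ?c y"] q x y B C by (simp add: subgroup.m_closed)
      then show "(snd \<circ> q) (x \<otimes> y) = (snd \<circ> q) x \<otimes>\<^bsub>G\<lparr>carrier := C\<rparr>\<^esub> (snd \<circ> q) y" by simp
    qed (simp add: q)
    show "kernel G (G\<lparr>carrier := C\<rparr>) (snd \<circ> q) = B"
    proof (intro equalityI subsetI)
      fix x assume "x \<in> kernel G (G\<lparr>carrier := C\<rparr>) (snd \<circ> q)"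
      then have x: "x \<in> carrier G" "snd (q x) = \<one>" by (auto simp: kernel_def)
      then have "x = fst (q x)" using q[OF x(1)] subgroup.mem_carrier[OF B] by (metis r_one)
      then show "x \<in> B" using q(1)[OF x(1)] by simp
    next
      fix x assume x: "x \<in> B"
      then have "x \<in> carrier G" using subgroup.mem_carrier[OF B] by simp
      then show "x \<in> kernel G (G\<lparr>carrier := C\<rparr>) (snd \<circ> q)"
        using p_eq[OF x subgroup.one_closed[OF C]] by (simp add: kernel_def)
    qed
  qed
qed

theorem proposition1p1:
  fixes G :: "('a, 'b) monoid_scheme" (structure)
  assumes "comm_group G"
  shows "bassian_finite G \<longleftrightarrow>
    (\<forall>\<phi> \<in> mon G G. \<forall>B. direct_summand B G \<and> B \<noteq> {\<one>} \<longrightarrow> \<phi> ` carrier G \<inter> B \<noteq> {\<one>})"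
    (is "_ \<longleftrightarrow> ?meets")
proof -
  interpret comm_group G by fact
  \<comment> \<open>Being a complement is symmetric: in both directions C must in turn be recognised
    as a summand.\<close>
  have sum_commute: "B <#> C = C <#> B" if "subgroup B G" "subgroup C G" for B C
    using commut_normal[OF that(1) subgroup_imp_normal[OF that(2)]] .
  show ?thesis
  proof
    assume bf: "bassian_finite G"
    show ?meets
    proof (intro ballI allI impI notI; elim conjE)
      fix \<phi> B
      assume \<phi>: "\<phi> \<in> mon G G" and summand: "direct_summand B G" and "B \<noteq> {\<one>}"
        and triv: "\<phi> ` carrier G \<inter> B = {\<one>}"
      obtain C where B: "subgroup B G" and C: "subgroup C G" and BC: "B \<inter> C = {\<one>}"
        and sum: "B <#> C = carrier G"
        using summand unfolding direct_summand_def by auto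
      obtain p where p: "p \<in> hom G (G\<lparr>carrier := C\<rparr>)" and ker: "kernel G (G\<lparr>carrier := C\<rparr>) p = B"
        using obtain_projection[OF B C BC sum] .
      have \<phi>_hom: "\<phi> \<in> hom G G" and \<phi>_inj: "inj_on \<phi> (carrier G)"
        using \<phi> by (auto simp: mon_def)
      have hom: "p \<circ> \<phi> \<in> hom G (G\<lparr>carrier := C\<rparr>)" using \<phi>_hom p by (simp add: hom_def Pi_iff)
      \<comment> \<open>Such an x has \<phi> x in the kernel B of p as well as in the image of
        \<phi>, so the trivial intersection applies.\<close>
      have "x = \<one>" if x: "x \<in> carrier G" and "(p \<circ> \<phi>) x = \<one>" for x
      proof -
        have "\<phi> x \<in> kernel G (G\<lparr>carrier := C\<rparr>) p"
          using that hom_in_carrier[OF \<phi>_hom x] by (simp add: kernel_def)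
        then have "\<phi> x = \<phi> \<one>"
          using x triv ker hom_one[OF \<phi>_hom is_group is_group] by auto
        then show ?thesis using \<phi>_inj x by (simp add: inj_on_eq_iff)
      qed
      with hom have "p \<circ> \<phi> \<in> mon G (G\<lparr>carrier := C\<rparr>)"
        by (simp add: mon_iff_hom_one[OF is_group subgroup_imp_group[OF C]])
      moreover have "direct_summand C G"
        unfolding direct_summand_def using B C BC sum sum_commute[OF B C] by blast
      moreover have "C \<noteq> carrier G"
        using BC \<open>B \<noteq> {\<one>}\<close> subgroup.subset[OF B] by auto
      ultimately show False using bf unfolding bassian_finite_def by blast
    qed
  next
    assume meets: ?meets
    show "bassian_finite G" unfolding bassian_finite_def
    proof (intro notI; elim exE conjE)
      fix B \<phi>
      assume summand: "direct_summand B G" and "B \<noteq> carrier G"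
        and \<phi>: "\<phi> \<in> mon G (G\<lparr>carrier := B\<rparr>)"
      obtain C where B: "subgroup B G" and C: "subgroup C G" and BC: "B \<inter> C = {\<one>}"
        and sum: "B <#> C = carrier G"
        using summand unfolding direct_summand_def by auto
      have im: "\<phi> ` carrier G \<subseteq> B" using \<phi> by (auto simp: mon_def hom_def)
      have \<phi>G: "\<phi> \<in> mon G G"
        using \<phi> subgroup.subset[OF B] by (auto simp: mon_def hom_def)
      have "\<one> = \<phi> \<one>" using \<phi>G hom_one[OF _ is_group is_group, of \<phi>] by (simp add: mon_def)
      \<comment> \<open>The intersection with C must equal {\<one>}, not merely be contained in
        it.\<close>
      then have "\<one> \<in> \<phi> ` carrier G" using one_closed by (rule image_eqI)
      then have "\<phi> ` carrier G \<inter> C = {\<one>}"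
        using im BC subgroup.one_closed[OF C] by auto
      moreover have "C \<noteq> {\<one>}"
      proof
        assume "C = {\<one>}"
        then have "B <#> C = B" using subgroup.mem_carrier[OF B] by (auto simp: set_mult_def)
        then show False using sum \<open>B \<noteq> carrier G\<close> by simp
      qed
      moreover have "direct_summand C G"
        unfolding direct_summand_def using B C BC sum sum_commute[OF B C] by blast
      ultimately show False using meets \<phi>G by blast
    qed
  qed
qed

end
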